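(* Let $\omega, n, k$ be positive integers with $n\ge 2k+1$, let $G=\mathbb{Z}_\omega$ be the cyclic group of order $\omega$, and let $G=A+B$ be a factorization, where $A=[0,n-k-1]\cup\{i_0,i_1,\ldots,i_{k-1}\}\subseteq \mathbb{Z}_\omega$ and $|A|=n$. Suppose that either (a) $\mu(\gcd(|A|,|B|))\le 1$, or (b) $\gcd(|A|,|B|)=pq$ for two distinct primes $p,q$, and $\gcd\left(pq,\frac{|B|}{\gcd(|A|,|B|)}\right)=1$. Then $\{i_0,i_1,\ldots,i_{k-1}\}\equiv\{n-k,n-k+1,\ldots,n-1\}\pmod n$.
   Context: For an additively written finite abelian group $G$ and nonempty subsets $A,B\subseteq G$, we say that $G=A+B$ is a factorization if every $g\in G$ can be written in exactly one way as $g=a+b$ with $a\in A$, $b\in B$; in particular $|A|\cdot|B|=|G|$. For integers $a\le b$, $[a,b]=\{x\in\mathbb{Z}: a\le x\le b\}$, viewed in $\mathbb{Z}_\omega$ via reduction modulo $\omega$. For a positive integer $r$, $\mu(r)$ denotes the number of distinct prime divisors of $r$. Since $|A|=n$ divides $\omega$, residues modulo $n$ of elements of $\mathbb{Z}_\omega$ are well defined; for sets $X,Y$, the notation $X\equiv Y\pmod n$ means that $X$ and $Y$ have the same set of residues modulo $n$. *)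

theory Defs
  imports "HOL-Algebra.Elementary_Groups" "HOL-Computational_Algebra.Primes"
begin

definition factorization :: "('a, 'b) monoid_scheme \<Rightarrow> 'a set \<Rightarrow> 'a set \<Rightarrow> bool" where
  "factorization G A B \<longleftrightarrow>
     comm_group G \<and> finite (carrier G) \<and>
     A \<subseteq> carrier G \<and> A \<noteq> {} \<and> B \<subseteq> carrier G \<and> B \<noteq> {} \<and>
     (\<forall>g \<in> carrier G. \<exists>!(a, b). a \<in> A \<and> b \<in> B \<and> g = a \<otimes>\<^bsub>G\<^esub> b)"

definition num_prime_divisors :: "nat \<Rightarrow> nat" where
  "num_prime_divisors r = card {p. prime p \<and> p dvd r}"

(* The library's integer_mod_group w has carrier {0..<w} (for w > 0), so reduction of
   integers into it is the map x \<mapsto> x mod w. *)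
definition reduced_interval :: "nat \<Rightarrow> int \<Rightarrow> int \<Rightarrow> int set" where
  "reduced_interval w a b = (\<lambda>x. x mod int w) ` {a..b}"

definition same_residues :: "nat \<Rightarrow> int set \<Rightarrow> int set \<Rightarrow> bool" where
  "same_residues n X Y \<longleftrightarrow> (\<lambda>x. x mod int n) ` X = (\<lambda>x. x mod int n) ` Y"

end

theory Submission
  imports Defs "HOL-Computational_Algebra.Polynomial"
begin

text \<open>If \<open>A + B\<close> is a factorization of \<open>Z_w\<close>, then so is \<open>A + r B\<close> for every \<open>r\<close> coprime to \<open>|B|\<close>
  (Tijdeman, Sands). Write \<open>n = N u\<close> and \<open>|B| = K v\<close>, where \<open>N\<close> and \<open>K\<close> collect the primes common to
  \<open>n\<close> and \<open>|B|\<close>. Passing to \<open>v A + u B\<close> and keeping only multiples of \<open>u v\<close> leaves a factorization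
  \<open>C + D\<close> of \<open>Z_{NK}\<close> with \<open>|C| = N\<close>, \<open>|D| = K\<close>, in which \<open>C\<close> contains an initial interval longer than \<open>N/2\<close>.
  Multiplying \<open>D\<close> by units modulo \<open>w\<close> shows that no two distinct elements of \<open>D\<close> can have a difference whose
  gcd with the modulus is at most \<open>N/2\<close>. In both cases this forces every element of \<open>D\<close> to be a multiple of \<open>N\<close>,
  so \<open>D\<close> is the full subgroup of multiples of \<open>N\<close>, and hence distinct elements of \<open>A\<close> are incongruent modulo \<open>n\<close>.\<close>

section \<open>Frobenius and Fermat congruences modulo a prime\<close>

text \<open>The inner binomial coefficients of a prime are multiples of it; induction adds one
  summand at a time. The generality serves two rings: the integers for Fermat's theorem, and
  \<open>int poly\<close> for the mask polynomial of a set.\<close>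

lemma power_prime_sum:
  fixes f :: "'b \<Rightarrow> 'a :: comm_ring_1"
  assumes "prime p" and "finite S"
  shows "\<exists>c. (\<Sum>x\<in>S. f x) ^ p = (\<Sum>x\<in>S. f x ^ p) + of_nat p * c"
  using \<open>finite S\<close>
proof (induction S rule: finite_induct)
  case empty
  then show ?case using assms(1) prime_gt_0_nat[of p] by (auto simp: zero_power intro!: exI[of _ 0])
next
  case (insert a S)
  then obtain c where c: "(\<Sum>x\<in>S. f x) ^ p = (\<Sum>x\<in>S. f x ^ p) + of_nat p * c" by blast
  let ?b = "\<Sum>x\<in>S. f x"
  have p: "p > 0" using assms(1) prime_gt_0_nat by blast
  have set: "{..p} = insert 0 (insert p {1..<p})" using p by auto
  have "(f a + ?b) ^ p = (\<Sum>k\<le>p. of_nat (p choose k) * f a ^ k * ?b ^ (p - k))"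
    by (rule binomial_ring)
  also have "\<dots> = ?b ^ p + (f a ^ p + (\<Sum>k\<in>{1..<p}. of_nat (p choose k) * f a ^ k * ?b ^ (p - k)))"
    using p unfolding set by (subst sum.insert, simp, simp)+ simp
  also have "(\<Sum>k\<in>{1..<p}. of_nat (p choose k) * f a ^ k * ?b ^ (p - k)) =
      of_nat p * (\<Sum>k\<in>{1..<p}. of_nat ((p choose k) div p) * f a ^ k * ?b ^ (p - k))"
    unfolding sum_distrib_left
  proof (rule sum.cong)
    fix k assume "k \<in> {1..<p}"
    then have "p dvd (p choose k)" using assms(1) by (intro dvd_choose_prime) auto
    then have "(of_nat (p choose k) :: 'a) = of_nat p * of_nat ((p choose k) div p)"
      by (metis dvd_mult_div_cancel of_nat_mult)
    then show "of_nat (p choose k) * f a ^ k * ?b ^ (p - k) =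
      of_nat p * (of_nat ((p choose k) div p) * f a ^ k * ?b ^ (p - k))"
      by (simp add: mult.assoc)
  qed simp
  finally show ?case using c insert.hyps
    by (auto simp: algebra_simps intro!: exI[of _ "c + (\<Sum>k\<in>{1..<p}. of_nat ((p choose k) div p) * f a ^ k * ?b ^ (p - k))"])
qed

lemma fermat_dvd:
  assumes "prime p" "\<not> p dvd c"
  shows "int p dvd int c ^ (p - 1) - 1"
proof -
  \<comment> \<open>\<open>int c\<close> is a sum of \<open>c\<close> ones, each its own
    \<open>p\<close>-th power.\<close>
  have "\<exists>e. int c ^ p = int c + int p * e"
    using power_prime_sum[OF assms(1), of "{..<c}" "\<lambda>_. 1 :: int"] by simp
  moreover have "int c ^ p = int c * int c ^ (p - 1)"
    using assms(1) prime_gt_0_nat[of p] by (cases p) auto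
  ultimately have "int p dvd int c * (int c ^ (p - 1) - 1)"
    by (auto simp: algebra_simps)
  moreover have "coprime (int p) (int c)"
    using assms by (simp add: prime_imp_coprime_nat)
  ultimately show ?thesis by (simp add: coprime_dvd_mult_right_iff)
qed

section \<open>Integer polynomials acting by translation\<close>

text \<open>The action of \<open>Z[x]\<close> on functions in which \<open>x\<close> acts as translation by 1.\<close>

definition poly_shift :: "int poly \<Rightarrow> (int \<Rightarrow> int) \<Rightarrow> int \<Rightarrow> int" where
  "poly_shift P f z = (\<Sum>i\<le>degree P. coeff P i * f (z - int i))"

lemma poly_shift_alt:
  assumes "degree P \<le> N"
  shows "poly_shift P f z = (\<Sum>i\<le>N. coeff P i * f (z - int i))"
  unfolding poly_shift_def using assms
  by (intro sum.mono_neutral_left) (auto simp: coeff_eq_0)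

lemma poly_shift_add: "poly_shift (P + Q) f z = poly_shift P f z + poly_shift Q f z"
proof -
  let ?N = "max (degree P) (degree Q)"
  show ?thesis
    using degree_add_le_max[of P Q]
    by (simp add: poly_shift_alt[where N = ?N] sum.distrib algebra_simps)
qed

lemma poly_shift_0 [simp]: "poly_shift 0 f z = 0"
  by (simp add: poly_shift_def)

lemma poly_shift_sum: "poly_shift (\<Sum>x\<in>S. P x) f z = (\<Sum>x\<in>S. poly_shift (P x) f z)"
  by (induction S rule: infinite_finite_induct) (auto simp: poly_shift_add)

lemma poly_shift_pCons: "poly_shift (pCons c P) f z = c * f z + poly_shift P f (z - 1)"
proof -
  have "poly_shift (pCons c P) f z = (\<Sum>i\<le>Suc (degree P). coeff (pCons c P) i * f (z - int i))"
    by (intro poly_shift_alt degree_pCons_le)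
  then show ?thesis
    by (simp add: sum.atMost_Suc_shift poly_shift_def algebra_simps del: sum.atMost_Suc)
qed

lemma poly_shift_monom_mult: "poly_shift (monom 1 n * P) f z = poly_shift P f (z - int n)"
  by (induction n arbitrary: z)
     (auto simp: monom_0 monom_Suc poly_shift_pCons algebra_simps)

lemma poly_shift_monom: "poly_shift (monom 1 n) f z = f (z - int n)"
  using poly_shift_monom_mult[of n 1 f z] by (simp add: poly_shift_def)

lemma dvd_poly_shift_of_nat: "int p dvd poly_shift (of_nat p * P) f z"
proof -
  have "of_nat p * P = smult (int p) P" by (simp add: of_nat_poly)
  then have "coeff (of_nat p * P) i = int p * coeff P i" for i by simp
  then show ?thesis unfolding poly_shift_def by (auto intro!: dvd_sum)
qed

section \<open>Factorizations modulo \<open>w\<close> by sets of integers\<close>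

text \<open>\<open>X + Y\<close> is a factorization of the subgroup \<open>hZ\<close> of \<open>Z_w\<close> (intended for \<open>h dvd w\<close>), where \<open>X\<close> and \<open>Y\<close> are sets of
  integers that need not be reduced modulo \<open>w\<close>.\<close>

definition tiles :: "int \<Rightarrow> int \<Rightarrow> int set \<Rightarrow> int set \<Rightarrow> bool" where
  "tiles w h X Y \<longleftrightarrow> bij_betw (\<lambda>(x, y). (x + y) mod w) (X \<times> Y) {z \<in> {0..<w}. h dvd z}"

lemma tiles_image:
  "tiles w h X Y \<Longrightarrow> (\<lambda>(x, y). (x + y) mod w) ` (X \<times> Y) = {z \<in> {0..<w}. h dvd z}"
  by (simp add: tiles_def bij_betw_def)

lemma tiles_eqD:
  assumes "tiles w h X Y" "x \<in> X" "y \<in> Y" "x' \<in> X" "y' \<in> Y" "w dvd (x + y) - (x' + y')"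
  shows "x = x'" "y = y'"
proof -
  have "inj_on (\<lambda>(x, y). (x + y) mod w) (X \<times> Y)"
    using assms(1) by (simp add: tiles_def bij_betw_def)
  moreover have "(x + y) mod w = (x' + y') mod w" using assms(6) by (simp only: mod_eq_dvd_iff)
  ultimately have "(x, y) = (x', y')"
    using assms(2-5) inj_onD[of "\<lambda>(x, y). (x + y) mod w" "X \<times> Y" "(x, y)" "(x', y')"] by simp
  then show "x = x'" "y = y'" by auto
qed

lemma tiles_cover:
  assumes "tiles w h X Y" "w > 0" "h dvd w" "h dvd z"
  obtains x y where "x \<in> X" "y \<in> Y" "w dvd z - (x + y)"
proof -
  have "z mod w \<in> {z \<in> {0..<w}. h dvd z}" using assms(2-4) by (simp add: dvd_mod_iff)
  then obtain x y where "x \<in> X" "y \<in> Y" "z mod w = (x + y) mod w"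
    unfolding tiles_image[OF assms(1), symmetric] by (elim imageE SigmaE) simp
  then show ?thesis using that by (simp add: mod_eq_dvd_iff)
qed

lemma tiles_dvd:
  assumes "tiles w h X Y" "h dvd w" "x \<in> X" "y \<in> Y"
  shows "h dvd x + y"
proof -
  have "(x + y) mod w \<in> (\<lambda>(x, y). (x + y) mod w) ` (X \<times> Y)"
    using assms(3,4) by (intro image_eqI[of _ _ "(x, y)"]) auto
  then show ?thesis unfolding tiles_image[OF assms(1)] using assms(2) by (simp add: dvd_mod_iff)
qed

lemma tilesI:
  assumes "w > 0" "h dvd w"
    and "\<And>x y. x \<in> X \<Longrightarrow> y \<in> Y \<Longrightarrow> h dvd x + y"
    and "\<And>z. h dvd z \<Longrightarrow> \<exists>x\<in>X. \<exists>y\<in>Y. w dvd z - (x + y)"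
    and "\<And>x y x' y'. x \<in> X \<Longrightarrow> y \<in> Y \<Longrightarrow> x' \<in> X \<Longrightarrow> y' \<in> Y \<Longrightarrow>
           w dvd (x + y) - (x' + y') \<Longrightarrow> x = x' \<and> y = y'"
  shows "tiles w h X Y"
  unfolding tiles_def bij_betw_def
proof
  show "inj_on (\<lambda>(x, y). (x + y) mod w) (X \<times> Y)"
    using assms(5) by (auto simp: inj_on_def mod_eq_dvd_iff)
  show "(\<lambda>(x, y). (x + y) mod w) ` (X \<times> Y) = {z \<in> {0..<w}. h dvd z}"
  proof (intro equalityI subsetI)
    fix z assume "z \<in> {z \<in> {0..<w}. h dvd z}"
    then obtain x y where "x \<in> X" "y \<in> Y" "w dvd z - (x + y)" "z mod w = z"
      using assms(4)[of z] by auto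
    then show "z \<in> (\<lambda>(x, y). (x + y) mod w) ` (X \<times> Y)"
      by (auto simp: mod_eq_dvd_iff[symmetric] intro!: rev_image_eqI[of "(x, y)"])
  qed (use assms in \<open>auto simp: dvd_mod_iff\<close>)
qed

lemma tiles_commute:
  assumes "tiles w h X Y" "w > 0" "h dvd w"
  shows "tiles w h Y X"
proof (rule tilesI[OF assms(2,3)])
  show "h dvd x + y" if "x \<in> Y" "y \<in> X" for x y
    using tiles_dvd[OF assms(1,3) that(2,1)] by (simp add: add.commute)
  show "\<exists>x\<in>Y. \<exists>y\<in>X. w dvd z - (x + y)" if "h dvd z" for z
    using tiles_cover[OF assms that] by (metis add.commute)
  show "x = x' \<and> y = y'"
    if "x \<in> Y" "y \<in> X" "x' \<in> Y" "y' \<in> X" "w dvd (x + y) - (x' + y')" for x y x' y'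
    using tiles_eqD[OF assms(1) that(2,1,4,3)] that(5) by (simp add: add.commute)
qed

lemma tiles_finite:
  assumes "tiles w h X Y" "w > 0"
  shows "finite X" "finite Y" "X \<noteq> {}" "Y \<noteq> {}"
proof -
  have "0 \<in> {z \<in> {0..<w}. h dvd z}" using assms(2) by auto
  then have ne: "X \<times> Y \<noteq> {}" using assms(1) unfolding tiles_def bij_betw_def by blast
  have "finite {z \<in> {0..<w}. h dvd z}" by (rule finite_subset[of _ "{0..<w}"]) auto
  then have "finite (X \<times> Y)" using assms(1) unfolding tiles_def by (simp add: bij_betw_finite)
  with ne show "finite X" "finite Y" "X \<noteq> {}" "Y \<noteq> {}"
    by (auto simp: finite_cartesian_product_iff)
qed

lemma card_multiples:
  fixes w h :: int
  assumes "w > 0" "h > 0" "h dvd w"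
  shows "card {z \<in> {0..<w}. h dvd z} = nat (w div h)"
proof -
  obtain c where c: "w = h * c" using assms(3) by blast
  have "{z \<in> {0..<w}. h dvd z} = (*) h ` {0..<c}"
    using assms c by (auto simp: zero_le_mult_iff elim!: dvdE)
  moreover have "inj_on ((*) h) {0..<c}" using assms(2) by (auto simp: inj_on_def)
  ultimately show ?thesis using c assms(2) by (simp add: card_image)
qed

lemma tiles_card:
  assumes "tiles w h X Y" "w > 0" "h > 0" "h dvd w"
  shows "int (card X * card Y) * h = w"
proof -
  have "card (X \<times> Y) = card {z \<in> {0..<w}. h dvd z}"
    using assms(1) unfolding tiles_def by (rule bij_betw_same_card)
  then have "card X * card Y = nat (w div h)"
    using card_multiples[OF assms(2-4)] by (simp only: card_cartesian_product)
  moreover have "w div h \<ge> 0" using assms(2,3) by (simp add: pos_imp_zdiv_nonneg_iff)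
  ultimately have "int (card X * card Y) = w div h" by (simp only: int_nat_eq if_True)
  then show ?thesis using assms(4) by (simp only: dvd_div_mult_self)
qed

text \<open>A surjection between finite sets of equal size is injective. This suits arguments that
  only show each element to have some representation.\<close>

lemma tiles_cover_cardI:
  assumes "w > 0" and "finite X" "finite Y" "int (card X * card Y) = w"
    and "\<And>z. \<exists>x\<in>X. \<exists>y\<in>Y. w dvd z - (x + y)"
  shows "tiles w 1 X Y"
proof -
  let ?f = "\<lambda>(x, y). (x + y) mod w"
  have sub: "{0..<w} \<subseteq> ?f ` (X \<times> Y)"
  proof
    fix z assume "z \<in> {0..<w}"
    then obtain x y where "x \<in> X" "y \<in> Y" "w dvd z - (x + y)" "z mod w = z"
      using assms(5)[of z] by auto
    then show "z \<in> ?f ` (X \<times> Y)"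
      by (auto simp: mod_eq_dvd_iff[symmetric] intro!: rev_image_eqI[of "(x, y)"])
  qed
  then have eq: "?f ` (X \<times> Y) = {0..<w}" using assms(1) by auto
  have "card (X \<times> Y) = nat w" using assms(4) unfolding card_cartesian_product by linarith
  then have "card (?f ` (X \<times> Y)) = card (X \<times> Y)" unfolding eq by simp
  then have "inj_on ?f (X \<times> Y)" using assms(2,3) by (intro eq_card_imp_inj_on) auto
  then show ?thesis using eq by (auto simp: tiles_def bij_betw_def)
qed

section \<open>Multiplying one factor by a coprime integer\<close>

text \<open>Since \<open>Y(x)^p\<close> and \<open>Y(x^p)\<close> are congruent modulo \<open>p\<close>, the number of representations \<open>z = x + p y\<close>
  is congruent to \<open>|Y|^(p - 1)\<close>, hence to 1, modulo \<open>p\<close>; in particular it is never 0.\<close>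

lemma tiles_mult_prime:
  assumes t: "tiles w 1 X Y" and w: "w > 0" and Y: "Y \<subseteq> {0..}"
    and p: "prime p" "\<not> p dvd card Y"
  shows "tiles w 1 X ((*) (int p) ` Y)"
proof (rule tiles_cover_cardI[OF w])
  note fin = tiles_finite[OF t w]
  have p0: "p > 0" using p(1) prime_gt_0_nat by blast
  show "finite X" "finite ((*) (int p) ` Y)" using fin by auto
  have "card ((*) (int p) ` Y) = card Y" using p0 by (intro card_image) (auto simp: inj_on_def)
  then show "int (card X * card ((*) (int p) ` Y)) = w" using tiles_card[OF t w] by simp
  fix z
  \<comment> \<open>\<open>f\<close> is the indicator of \<open>X\<close>, made periodic modulo
    \<open>w\<close>. The factorization then says that the mask polynomial of \<open>Y\<close> sends
    \<open>f\<close> to the constant 1.\<close>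
  define f :: "int \<Rightarrow> int" where "f z = (if \<exists>x\<in>X. w dvd z - x then 1 else 0)" for z
  have f_sum: "(\<Sum>y\<in>Y. f (z - y)) = 1" for z
  proof -
    obtain x y where xy: "x \<in> X" "y \<in> Y" "w dvd z - (x + y)"
      using tiles_cover[OF t w, of z] by auto
    have "f (z - y') = (if y' = y then 1 else 0)" if y': "y' \<in> Y" for y'
    proof (cases "y' = y")
      case True
      have "w dvd z - y - x" using xy(3) by (simp add: algebra_simps)
      then show ?thesis using True xy(1) unfolding f_def by auto
    next
      case False
      have "\<not> w dvd z - y' - x'" if x': "x' \<in> X" for x'
      proof
        assume "w dvd z - y' - x'"
        then have "w dvd (z - y' - x') - (z - (x + y))" using xy(3) by (rule dvd_diff)
        then have "w dvd (x + y) - (x' + y')" by (simp add: algebra_simps)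
        then show False using tiles_eqD(2)[OF t xy(1,2) x' y'] False by simp
      qed
      then show ?thesis using False unfolding f_def by auto
    qed
    then have "(\<Sum>y\<in>Y. f (z - y)) = (\<Sum>y'\<in>Y. if y' = y then 1 else 0)"
      by (rule sum.cong[OF refl])
    then show ?thesis using xy(2) fin(2) by simp
  qed
  \<comment> \<open>The mask polynomial of \<open>Y\<close>; its exponents \<open>nat y\<close> are
    faithful because \<open>Y\<close> has no negative elements.\<close>
  let ?P = "\<Sum>y\<in>Y. monom 1 (nat y) :: int poly"
  have P_mult: "poly_shift (?P * Q) f z = (\<Sum>y\<in>Y. poly_shift Q f (z - y))" for Q z
    unfolding sum_distrib_right poly_shift_sum poly_shift_monom_mult
    using Y by (intro sum.cong) auto
  \<comment> \<open>The first factor turns \<open>f\<close> into the constant 1 and each further one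
    multiplies by \<open>card Y\<close>. Hence the exponent lags by one, which produces Fermat's
    \<open>p - 1\<close>.\<close>
  have pow: "poly_shift (?P ^ Suc j) f z = int (card Y) ^ j" for j z
  proof (induction j arbitrary: z)
    case 0
    have "poly_shift 1 f z = f z" for z by (simp add: poly_shift_def)
    then show ?case using P_mult[of 1 z] f_sum by simp
  next
    case (Suc j)
    have "poly_shift (?P ^ Suc (Suc j)) f z = (\<Sum>y\<in>Y. poly_shift (?P ^ Suc j) f (z - y))"
      unfolding power_Suc[of ?P "Suc j"] by (rule P_mult)
    also have "\<dots> = int (card Y) ^ Suc j" unfolding Suc.IH by simp
    finally show ?case .
  qed
  obtain c where c: "?P ^ p = (\<Sum>y\<in>Y. monom 1 (nat y) ^ p) + of_nat p * c"
    using power_prime_sum[OF p(1) fin(2)] by blast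
  have "poly_shift (\<Sum>y\<in>Y. monom 1 (nat y) ^ p) f z = (\<Sum>y\<in>Y. f (z - int p * y))"
    unfolding poly_shift_sum using Y
    by (intro sum.cong) (auto simp: monom_power poly_shift_monom mult.commute)
  moreover have "poly_shift (?P ^ p) f z = int (card Y) ^ (p - 1)"
    using pow[of "p - 1" z] p0 by (simp only: Suc_diff_1)
  ultimately have "int (card Y) ^ (p - 1) - 1 - poly_shift (of_nat p * c) f z
      = (\<Sum>y\<in>Y. f (z - int p * y)) - 1"
    unfolding c poly_shift_add by simp
  moreover have "int p dvd int (card Y) ^ (p - 1) - 1 - poly_shift (of_nat p * c) f z"
    using fermat_dvd[OF p] dvd_poly_shift_of_nat by (rule dvd_diff)
  ultimately have dvd: "int p dvd (\<Sum>y\<in>Y. f (z - int p * y)) - 1" by (simp only:)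
  have "(\<Sum>y\<in>Y. f (z - int p * y)) \<noteq> 0"
  proof
    assume "(\<Sum>y\<in>Y. f (z - int p * y)) = 0"
    then have "int p dvd 1" using dvd by simp
    then show False using prime_gt_1_nat[OF p(1)] by simp
  qed
  then obtain y where y: "y \<in> Y" "f (z - int p * y) \<noteq> 0" by (meson sum.neutral)
  then obtain x where "x \<in> X" "w dvd z - int p * y - x" by (auto simp: f_def split: if_splits)
  then have "w dvd z - (x + int p * y)" by (simp add: algebra_simps)
  with \<open>x \<in> X\<close> y(1) show "\<exists>x\<in>X. \<exists>y\<in>(*) (int p) ` Y. w dvd z - (x + y)" by blast
qed

text \<open>Multiply by the prime factors of \<open>r\<close> one after another; each step keeps
  \<open>card Y\<close>, so the remaining cofactor stays coprime to it.\<close>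

lemma tiles_mult:
  assumes "tiles w 1 X Y" "w > 0" "Y \<subseteq> {0..}" "r > 0" "coprime r (card Y)"
  shows "tiles w 1 X ((*) (int r) ` Y)"
  using assms(1,3-5)
proof (induction r arbitrary: Y rule: prime_divisors_induct)
  case (factor p r)
  then have "p > 0" by (auto simp: prime_gt_0_nat)
  have "coprime p (card Y)" using factor.prems by (simp add: coprime_mult_left_iff)
  then have "\<not> p dvd card Y"
    using \<open>prime p\<close> coprime_absorb_left not_prime_unit by blast
  then have 1: "tiles w 1 X ((*) (int p) ` Y)"
    using factor assms by (intro tiles_mult_prime) auto
  have 2: "card ((*) (int p) ` Y) = card Y"
    using \<open>p > 0\<close> by (intro card_image) (auto simp: inj_on_def)
  have "tiles w 1 X ((*) (int r) ` (*) (int p) ` Y)"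
  proof (rule factor.IH[OF 1])
    show "(*) (int p) ` Y \<subseteq> {0..}" using factor.prems by auto
    show "r > 0" using factor.prems by simp
    show "coprime r (card ((*) (int p) ` Y))"
      using factor.prems unfolding 2 by (simp add: coprime_mult_left_iff)
  qed
  then show ?case by (simp add: image_image mult_ac)
qed simp_all

section \<open>Subgroups, units modulo \<open>w\<close>, and differences within a factor\<close>

text \<open>When \<open>Y\<close> lies inside the smaller subgroup, \<open>x + y\<close> lies in it
  exactly when \<open>x\<close> does, so only \<open>X\<close> has to be cut down.\<close>

lemma tiles_restrict:
  assumes t: "tiles w h X Y" and "w > 0" and hh: "h dvd h'" "h' dvd w"
    and Y: "\<And>y. y \<in> Y \<Longrightarrow> h' dvd y"
  shows "tiles w h' {x \<in> X. h' dvd x} Y"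
proof (rule tilesI[OF assms(2) hh(2)])
  show "h' dvd x + y" if "x \<in> {x \<in> X. h' dvd x}" "y \<in> Y" for x y
    using that Y by auto
  show "\<exists>x\<in>{x \<in> X. h' dvd x}. \<exists>y\<in>Y. w dvd z - (x + y)" if z: "h' dvd z" for z
  proof -
    obtain x y where xy: "x \<in> X" "y \<in> Y" "w dvd z - (x + y)"
      using tiles_cover[OF t assms(2) dvd_trans[OF hh] dvd_trans[OF hh(1) z]] .
    have "h' dvd (z - y) - (z - (x + y))"
      using dvd_diff[OF dvd_diff[OF z Y[OF xy(2)]] dvd_trans[OF hh(2) xy(3)]] .
    then have "h' dvd x" by simp
    with xy show ?thesis by blast
  qed
  show "x = x' \<and> y = y'"
    if "x \<in> {x \<in> X. h' dvd x}" "y \<in> Y" "x' \<in> {x \<in> X. h' dvd x}" "y' \<in> Y"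
      "w dvd (x + y) - (x' + y')" for x y x' y'
    using tiles_eqD[OF t, of x y x' y'] that by simp
qed

lemma coprimeI_prime:
  fixes a b :: "'a :: factorial_semiring_gcd"
  assumes "b \<noteq> 0" "\<And>p. prime p \<Longrightarrow> p dvd a \<Longrightarrow> p dvd b \<Longrightarrow> False"
  shows "coprime a b"
proof (rule ccontr)
  assume "\<not> coprime a b"
  then have "\<not> is_unit (gcd a b)" by (simp only: is_unit_gcd not_False_eq_True)
  then obtain p where "prime p" "p dvd gcd a b"
    using assms(1) prime_divisor_exists[of "gcd a b"] by auto
  then show False using assms(2)[of p] by simp
qed

text \<open>Take for \<open>z\<close> the product of the primes of \<open>w\<close> that do not
  divide \<open>u\<close>. Each prime divisor of \<open>w\<close> then divides exactly one of the
  summands \<open>u\<close> and \<open>L * z\<close>.\<close>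

lemma ex_coprime_shift:
  fixes u L w :: int
  assumes "coprime u L" "w > 0"
  shows "\<exists>z. coprime (u + L * z) w"
proof -
  define P where "P = {p. prime p \<and> p dvd w \<and> \<not> p dvd u}"
  have "P \<subseteq> {0..w}" using assms(2) by (auto simp: P_def prime_ge_0_int zdvd_imp_le)
  then have fin: "finite P" by (rule finite_subset) simp
  have "coprime (u + L * \<Prod>P) w"
  proof (rule coprimeI_prime)
    fix p assume p: "prime p" "p dvd u + L * \<Prod>P" "p dvd w"
    have iff: "p dvd \<Prod>P \<longleftrightarrow> p \<in> P"
    proof
      assume "p dvd \<Prod>P"
      then obtain q where "q \<in> P" "p dvd q" using p(1) fin by (auto simp: prime_dvd_prod_iff)
      then show "p \<in> P" using p(1) primes_dvd_imp_eq[of p q] by (auto simp: P_def)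
    qed (use fin in auto)
    show False
    proof (cases "p dvd u")
      case True
      then have "p dvd L * \<Prod>P" using p(2) by (simp add: dvd_add_right_iff)
      moreover have "p \<notin> P" using True by (simp add: P_def)
      ultimately have "p dvd L" using iff p(1) prime_dvd_mult_iff by blast
      then show False using True assms(1) p(1) by (meson coprime_common_divisor not_prime_unit)
    next
      case False
      then have "p dvd \<Prod>P" using iff p by (simp add: P_def)
      then have "p dvd u" using p(2) by (simp add: dvd_add_left_iff)
      then show False using False by simp
    qed
  qed (use assms in auto)
  then show ?thesis by blast
qed

text \<open>\<open>t\<close> and \<open>gcd t w\<close> generate the same subgroup modulo
  \<open>w\<close>, hence differ by a unit. Bezout gives a unit modulo
  \<open>L = w / gcd t w\<close>, which is then lifted to a unit modulo \<open>w\<close>.\<close>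

lemma ex_unit_mult_eq_gcd:
  fixes t w :: int
  assumes "w > 0"
  shows "\<exists>r::nat. r > 0 \<and> coprime (int r) w \<and> w dvd int r * t - gcd t w"
proof -
  define g where "g = gcd t w"
  have g: "g > 0" using assms by (simp add: g_def)
  have "g dvd t" "g dvd w" by (simp_all add: g_def)
  then obtain t0 L where tL: "t = g * t0" "w = g * L" by (elim dvdE)
  have "gcd (g * t0) (g * L) = g" unfolding tL[symmetric] by (simp only: g_def)
  then have "g * gcd t0 L = g" using g by (simp add: gcd_mult_left abs_mult)
  then have "coprime t0 L" using g by (simp add: coprime_iff_gcd_eq_1)
  then obtain a b where ab: "a * t0 + b * L = 1" using bezout_int[of t0 L] by auto
  have "coprime a L"
  proof (rule coprimeI)
    fix c assume "c dvd a" "c dvd L"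
    then have "c dvd a * t0 + b * L" by simp
    then show "is_unit c" unfolding ab .
  qed
  then obtain z where z: "coprime (a + L * z) w" using ex_coprime_shift assms by blast
  \<comment> \<open>The extra \<open>w\<close> keeps \<open>r\<close> positive even when the residue
    is 0.\<close>
  define r where "r = nat ((a + L * z) mod w + w)"
  have m0: "(a + L * z) mod w \<ge> 0" using assms by (rule pos_mod_sign)
  then have r: "int r = (a + L * z) mod w + w" using assms by (simp add: r_def)
  have "(a + L * z) mod w + w > 0" using m0 assms by linarith
  then have "r > 0" by (simp only: r_def zero_less_nat_eq)
  define e where "e = 1 - (a + L * z) div w"
  have re: "int r = a + L * z + w * e"
    unfolding r e_def using mult_div_mod_eq[of w "a + L * z"] by (simp only: right_diff_distrib)
  have "coprime (int r) w"
  proof (rule coprimeI)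
    fix c assume c: "c dvd int r" "c dvd w"
    then have "c dvd int r - w * e" by (intro dvd_diff dvd_mult2)
    then have "c dvd a + L * z" unfolding re by simp
    with z c(2) show "is_unit c" using coprime_common_divisor by blast
  qed
  moreover have "w dvd int r * t - g"
  proof -
    have "int r * t - g = w * (z * t0 - b + e * t) + g * (a * t0 + b * L - 1)"
      unfolding re tL by (simp add: algebra_simps)
    then show ?thesis unfolding ab by simp
  qed
  ultimately show ?thesis using \<open>r > 0\<close> unfolding g_def by blast
qed

text \<open>Multiply \<open>Y\<close> by a unit \<open>r\<close> that carries \<open>y - y'\<close>
  to its gcd with \<open>w\<close>. Then \<open>0 + r y\<close> and
  \<open>gcd (y - y') w + r y'\<close> represent the same element, which forces the gcd to be 0,
  absurd for \<open>w > 0\<close>.\<close>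

lemma tiles_gcd_diff:
  assumes t: "tiles w 1 X Y" and w: "w > 0" and Y: "Y \<subseteq> {0..}"
    and "0 \<in> X" "y \<in> Y" "y' \<in> Y" "gcd (y - y') w \<in> X"
  shows "y = y'"
proof -
  obtain r :: nat where r: "r > 0" "coprime (int r) w" "w dvd int r * (y - y') - gcd (y - y') w"
    using ex_unit_mult_eq_gcd[OF w] by blast
  have "int (card Y) dvd w" using tiles_card[OF t w] by (metis dvd_triv_right mult.right_neutral of_nat_mult one_dvd zero_less_one)
  then have "coprime r (card Y)"
    using r(2) by (metis coprime_int_iff coprime_divisors dvd_refl)
  then have t': "tiles w 1 X ((*) (int r) ` Y)" using tiles_mult[OF t w Y r(1)] by blast
  have "w dvd (0 + int r * y) - (gcd (y - y') w + int r * y')"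
    using r(3) by (simp add: algebra_simps)
  then have "0 = gcd (y - y') w" using tiles_eqD(1)[OF t'] assms(4-7) by blast
  then show ?thesis using w by simp
qed

text \<open>Translating by an element of \<open>Y\<close> puts 0 into the factor; reducing modulo
  \<open>w\<close> keeps it nonnegative, as multiplication of factors requires.\<close>

lemma tiles_translate:
  assumes t: "tiles w 1 X Y" and w: "w > 0"
  shows "tiles w 1 X ((\<lambda>y. (y - c) mod w) ` Y)"
proof (rule tilesI[OF w])
  have m: "w dvd x mod w - x" for x by (simp add: minus_div_mult_eq_mod[symmetric])
  show "\<exists>x\<in>X. \<exists>y\<in>(\<lambda>y. (y - c) mod w) ` Y. w dvd z - (x + y)" for z
  proof -
    obtain x y where xy: "x \<in> X" "y \<in> Y" "w dvd (z + c) - (x + y)"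
      using tiles_cover[OF t w, of "z + c"] by auto
    have "w dvd ((z + c) - (x + y)) - ((y - c) mod w - (y - c))" using xy(3) m by (rule dvd_diff)
    then have "w dvd z - (x + (y - c) mod w)" by (simp add: algebra_simps)
    with xy(1,2) show ?thesis by blast
  qed
  fix x y x' y'
  assume x: "x \<in> X" "x' \<in> X" and y: "y \<in> (\<lambda>y. (y - c) mod w) ` Y" "y' \<in> (\<lambda>y. (y - c) mod w) ` Y"
    and d: "w dvd (x + y) - (x' + y')"
  obtain e e' where e: "e \<in> Y" "y = (e - c) mod w" "e' \<in> Y" "y' = (e' - c) mod w" using y by auto
  have "w dvd ((x + y) - (x' + y')) - (((e - c) mod w - (e - c)) - ((e' - c) mod w - (e' - c)))"
    using d dvd_diff[OF m m] by (rule dvd_diff)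
  then have "w dvd (x + e) - (x' + e')" unfolding e by (simp add: algebra_simps)
  then have "x = x' \<and> e = e'" using tiles_eqD[OF t x(1) e(1) x(2) e(3)] by blast
  then show "x = x' \<and> y = y'" using e by blast
qed auto

section \<open>Reduction to the common primes of the two cardinalities\<close>

text \<open>Removes \<open>u\<close> and \<open>v\<close>, so that the later case analyses only have
  to derive from the lower bound on gcds of differences that \<open>D\<close> consists of multiples
  of \<open>N u v\<close>. The last clause turns this into injectivity on \<open>A\<close>.\<close>

lemma reduced_tiling:
  fixes N K u v :: nat
  assumes pos: "N > 0" "K > 0" "u > 0" "v > 0" and w: "w = int (N * K * u * v)"
    and t: "tiles w 1 A B" and cA: "card A = N * u" and cB: "card B = K * v"
    and A: "{0..L} \<subseteq> A" "A \<subseteq> {0..}" "L \<ge> 0" "2 * (L + 1) > int (N * u)"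
    and B: "0 \<in> B" "B \<subseteq> {0..}"
    and cop: "coprime u (K * v)" "coprime v (N * u)"
  shows "\<exists>C D. tiles w (int (u * v)) C D \<and> card D = K \<and> 0 \<in> C \<and> 0 \<in> D \<and>
    (\<forall>d\<in>D. \<forall>d'\<in>D. d \<noteq> d' \<longrightarrow> int (N * (u * v)) < 2 * gcd (d - d') w) \<and>
    ((\<forall>d\<in>D. int (N * (u * v)) dvd d) \<longrightarrow> inj_on (\<lambda>x. x mod int (N * u)) A)"
proof -
  let ?uB = "(*) (int u) ` B" and ?vA = "(*) (int v) ` A"
  have w0: "w > 0" using pos w by simp
  have cuv: "coprime u v" using cop(1) by simp
  \<comment> \<open>\<open>u\<close> is coprime to \<open>card B\<close> and \<open>v\<close> to
    \<open>card A\<close>, so \<open>B\<close> may be multiplied first and then, with the factors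
    swapped, \<open>A\<close>.\<close>
  have t1: "tiles w 1 A ?uB" using tiles_mult[OF t w0 B(2) pos(3)] cop(1) cB by simp
  have cuB: "card ?uB = K * v" using pos(3) cB by (subst card_image) (auto simp: inj_on_def)
  have uB: "?uB \<subseteq> {0..}" using B(2) by auto
  have "tiles w 1 ?uB ?vA"
    using tiles_mult[OF tiles_commute[OF t1 w0 one_dvd] w0 A(2) pos(4)] cop(2) cA by simp
  then have t2: "tiles w 1 ?vA ?uB" by (rule tiles_commute[OF _ w0 one_dvd])
  define A0 where "A0 = {a \<in> A. int u dvd a}"
  define C where "C = {x \<in> ?vA. int u dvd x}"
  define D where "D = {y \<in> ?uB. int (u * v) dvd y}"
  have u_w: "int u dvd w" and uv_w: "int (u * v) dvd w" and Nuv_w: "int (N * (u * v)) dvd w"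
    unfolding w by (auto simp: mult_ac)
  \<comment> \<open>\<open>u B\<close> already consists of multiples of \<open>u\<close>, so only
    \<open>A\<close> shrinks; comparing orders leaves \<open>N\<close> elements.\<close>
  have t3: "tiles w (int u) A0 ?uB"
    unfolding A0_def using w0 u_w by (intro tiles_restrict[OF t1]) auto
  have cA0: "card A0 = N"
  proof -
    have "int (card A0 * card ?uB) * int u = w" using tiles_card[OF t3 w0] u_w pos by simp
    then have "int (card A0) * int (K * v * u) = int N * int (K * v * u)"
      unfolding cuB w by (simp add: mult_ac)
    then show ?thesis using pos by simp
  qed
  have C: "C = (*) (int v) ` A0"
  proof -
    have "int u dvd int v * a \<longleftrightarrow> int u dvd a" for a
      using cuv by (intro coprime_dvd_mult_right_iff) simp
    then show ?thesis unfolding C_def A0_def by auto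
  qed
  have cC: "card C = N" unfolding C using pos(4) cA0 by (subst card_image) (auto simp: inj_on_def)
  have t4: "tiles w (int u) C ?uB"
    unfolding C_def using w0 u_w by (intro tiles_restrict[OF t2]) auto
  have "int (u * v) dvd x" if "x \<in> C" for x using that unfolding C A0_def by auto
  \<comment> \<open>Now \<open>C\<close> lies in the multiples of \<open>u v\<close>, so the
    restriction falls on the other factor.\<close>
  then have "tiles w (int (u * v)) D C"
    unfolding D_def using w0 uv_w u_w
    by (intro tiles_restrict[OF tiles_commute[OF t4 w0 u_w]]) auto
  then have t5: "tiles w (int (u * v)) C D" by (rule tiles_commute[OF _ w0 uv_w])
  have "int (card C * card D) * int (u * v) = w" using tiles_card[OF t5 w0] uv_w pos by simp
  then have "int (card D) * int (N * u * v) = int K * int (N * u * v)"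
    unfolding cC w by (simp add: mult_ac)
  then have cD: "card D = K" using pos by simp
  have "0 \<in> A" using A by auto
  then have C0: "0 \<in> C" and vA0: "0 \<in> ?vA" unfolding C_def by (auto intro!: image_eqI[of _ _ 0])
  have D0: "0 \<in> D" using B(1) unfolding D_def by (auto intro!: image_eqI[of _ _ 0])
  \<comment> \<open>Write the gcd as \<open>u v g\<close>. If the bound failed, \<open>2 u g\<close>
    would be at most \<open>N u\<close>, hence below \<open>2 (L + 1)\<close>; so \<open>u g\<close>
    would lie in the initial interval of \<open>A\<close> and the gcd in \<open>v A\<close>,
    contrary to \<open>tiles_gcd_diff\<close>.\<close>
  have sep: "int (N * (u * v)) < 2 * gcd (d - d') w" if d: "d \<in> D" "d' \<in> D" "d \<noteq> d'" for d d'
  proof (rule ccontr)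
    assume "\<not> ?thesis"
    then have le: "2 * gcd (d - d') w \<le> int (N * (u * v))" by simp
    have "int (u * v) dvd gcd (d - d') w" using d uv_w unfolding D_def by (auto intro: dvd_diff)
    then obtain g where g: "gcd (d - d') w = int (u * v) * g" by blast
    have "int (u * v) * g \<ge> 0" unfolding g[symmetric] by simp
    moreover have "int (u * v) > 0" using pos by simp
    ultimately have "g \<ge> 0" using mult_pos_neg not_le by blast
    have "int v * (2 * (int u * g)) \<le> int v * int (N * u)" using le unfolding g by (simp add: mult_ac)
    then have "2 * (int u * g) \<le> int (N * u)" using pos(4) by simp
    then have "int u * g \<in> {0..L}" using A(4) \<open>g \<ge> 0\<close> by simp
    then have "int v * (int u * g) \<in> ?vA" using A(1) by blast
    then have "gcd (d - d') w \<in> ?vA" unfolding g by (simp add: mult_ac)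
    then have "d = d'" using tiles_gcd_diff[OF t2 w0 uB vA0] d(1,2) unfolding D_def by blast
    then show False using d(3) by simp
  qed
  have inj: "inj_on (\<lambda>x. x mod int (N * u)) A" if D: "\<forall>d\<in>D. int (N * (u * v)) dvd d"
  proof (rule inj_onI)
    fix a a' assume a: "a \<in> A" "a' \<in> A" "a mod int (N * u) = a' mod int (N * u)"
    let ?h = "int (N * (u * v))"
    \<comment> \<open>The multiples of \<open>?h\<close> form a group of order
      \<open>K = card D\<close>, so \<open>D\<close> fills it alone and only 0 remains of
      \<open>C\<close>.\<close>
    have t6: "tiles w ?h {x \<in> C. ?h dvd x} D"
      using D w0 Nuv_w by (intro tiles_restrict[OF t5]) auto
    have "int (card {x \<in> C. ?h dvd x} * card D) * ?h = w"
      using tiles_card[OF t6 w0] Nuv_w pos by simp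
    then have "int (card {x \<in> C. ?h dvd x}) * int (K * N * u * v) = 1 * int (K * N * u * v)"
      unfolding cD w by (simp add: mult_ac)
    then have "card {x \<in> C. ?h dvd x} = 1" using pos by simp
    moreover have "0 \<in> {x \<in> C. ?h dvd x}" using C0 by simp
    ultimately have single: "{x \<in> C. ?h dvd x} = {0}" by (metis card_1_singletonE singletonD)
    have "int (N * u) dvd a - a'" using a(3) by (simp only: mod_eq_dvd_iff)
    then have "?h dvd int v * (a - a')" by (auto simp: mult_ac)
    then obtain x y where xy: "x \<in> {x \<in> C. ?h dvd x}" "y \<in> D" "w dvd int v * (a - a') - (x + y)"
      using tiles_cover[OF t6 w0 Nuv_w] by blast
    have "x = 0" using xy(1) unfolding single by simp
    \<comment> \<open>\<open>v (a - a')\<close> is congruent to some \<open>y\<close> in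
      \<open>D\<close>, hence in \<open>u B\<close>; so \<open>v a + 0\<close> and
      \<open>v a' + y\<close> are representations of one element in
      \<open>v A + u B\<close>.\<close>
    then have "w dvd (int v * a + 0) - (int v * a' + y)" using xy(3) by (simp add: algebra_simps)
    moreover have "0 \<in> ?uB" "y \<in> ?uB" using D0 xy(2) unfolding D_def by auto
    ultimately have "int v * a = int v * a'" using tiles_eqD(1)[OF t2] a(1,2) by blast
    then show "a = a'" using pos(4) by simp
  qed
  show ?thesis using t5 cD C0 D0 sep inj by blast
qed

section \<open>Large divisors and families of differences\<close>

lemma dvd_prime_power_Suc_mult:
  fixes g p m :: nat
  assumes "prime p" "g dvd p ^ Suc a * m" "\<not> p ^ Suc a dvd g"
  shows "g dvd p ^ a * m"
proof -
  obtain x y where xy: "g = x * y" "x dvd p ^ Suc a" "y dvd m"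
    using division_decomp[OF assms(2)] by blast
  obtain i where i: "i \<le> Suc a" "x = p ^ i" using xy(2) divides_primepow_nat[OF assms(1)] by blast
  have "i \<noteq> Suc a" using assms(3) xy(1) i(2) by auto
  then have "x dvd p ^ a" using i by (simp add: le_imp_power_dvd)
  then show ?thesis using xy(1,3) by (simp add: mult_dvd_mono)
qed

text \<open>\<open>g\<close> is a power of \<open>p\<close>; with exponent below \<open>a\<close> it
  would be at most half of \<open>p ^ a\<close>.\<close>

lemma large_prime_power_divisor:
  fixes g p :: nat
  assumes "prime p" "g dvd p ^ b" "p ^ a < 2 * g"
  shows "p ^ a dvd g"
proof -
  obtain i where i: "g = p ^ i" using assms(1,2) divides_primepow_nat by blast
  have "a \<le> i"
  proof (rule ccontr)
    assume "\<not> a \<le> i"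
    then obtain j where "a = i + Suc j" using less_imp_Suc_add[of i a] by auto
    then have "p ^ a = (p * p ^ j) * g" using i by (simp add: power_add)
    moreover have "2 * 1 \<le> p * p ^ j" using prime_ge_2_nat[OF assms(1)]
      by (intro mult_le_mono) (auto simp: Suc_le_eq)
    ultimately have "2 * g \<le> p ^ a" by (metis mult_le_mono1 mult.right_neutral)
    then show False using assms(3) by simp
  qed
  then show ?thesis unfolding i by (rule le_imp_power_dvd)
qed

text \<open>If neither full prime power divides \<open>g\<close>, then \<open>g\<close> divides
  \<open>p ^ a * q ^ b\<close>; exceeding half of it, \<open>g\<close> equals it.\<close>

lemma large_divisor_two_primes:
  fixes g p q :: nat
  assumes "prime p" "prime q" "g dvd p ^ Suc a * q ^ Suc b" "p ^ a * q ^ b < 2 * g"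
  shows "p ^ Suc a dvd g \<or> q ^ Suc b dvd g \<or> p ^ a * q ^ b dvd g"
proof (intro disjCI)
  assume *: "\<not> (q ^ Suc b dvd g \<or> p ^ a * q ^ b dvd g)"
  show "p ^ Suc a dvd g"
  proof (rule ccontr)
    assume "\<not> p ^ Suc a dvd g"
    then have "g dvd q ^ Suc b * p ^ a"
      using dvd_prime_power_Suc_mult[OF assms(1,3)] by (subst mult.commute)
    then have "g dvd q ^ b * p ^ a" using dvd_prime_power_Suc_mult[OF assms(2)] * by blast
    then obtain c where c: "p ^ a * q ^ b = g * c" unfolding mult.commute[of "q ^ b"] by (elim dvdE)
    have "p ^ a * q ^ b > 0" using assms(1,2) by (simp add: prime_gt_0_nat)
    then have "c < 2" "c > 0" using assms(4) unfolding c by auto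
    then have "c = 1" by simp
    then show False using c * by simp
  qed
qed

text \<open>Passes from an alternative for each pair to one alternative for the whole set. An
  element violating the third alternative decides which of the other two holds everywhere.\<close>

lemma common_divisor_of_differences:
  fixes S :: "int set"
  assumes "0 \<in> S"
    and d: "\<And>s t. s \<in> S \<Longrightarrow> t \<in> S \<Longrightarrow> P' dvd s - t \<or> Q' dvd s - t \<or> (P dvd s - t \<and> Q dvd s - t)"
    and PQ: "P dvd P'" "Q dvd Q'"
  shows "(\<forall>s\<in>S. P' dvd s) \<or> (\<forall>s\<in>S. Q' dvd s) \<or> (\<forall>s\<in>S. P dvd s \<and> Q dvd s)"
proof -
  \<comment> \<open>If \<open>Q'\<close> failed to divide \<open>t\<close>, then \<open>P\<close>
    would divide both \<open>t\<close> (compared with 0) and \<open>t - s0\<close>, hence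
    \<open>s0\<close>. This is used twice, with the roles of the two moduli exchanged.\<close>
  have one: "\<forall>s\<in>S. Q' dvd s"
    if d: "\<And>s t. s \<in> S \<Longrightarrow> t \<in> S \<Longrightarrow> P' dvd s - t \<or> Q' dvd s - t \<or> P dvd s - t"
      and "P dvd P'" "s0 \<in> S" "Q' dvd s0" "\<not> P dvd s0" for P Q' P' s0 :: int
  proof (rule ballI, rule ccontr)
    fix t assume t: "t \<in> S" "\<not> Q' dvd t"
    have "P dvd t" using d[OF t(1) \<open>0 \<in> S\<close>] t(2) dvd_trans[OF \<open>P dvd P'\<close>] by auto
    moreover have "\<not> Q' dvd t - s0" using t(2) \<open>Q' dvd s0\<close> by (metis dvd_add_left_iff diff_add_cancel)
    then have "P dvd t - s0" using d[OF t(1) \<open>s0 \<in> S\<close>] dvd_trans[OF \<open>P dvd P'\<close>] by blast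
    ultimately have "P dvd t - (t - s0)" by (rule dvd_diff)
    then show False using \<open>\<not> P dvd s0\<close> by simp
  qed
  show ?thesis
  proof (cases "\<forall>s\<in>S. P dvd s \<and> Q dvd s")
    case False
    then obtain s0 where s0: "s0 \<in> S" "\<not> (P dvd s0 \<and> Q dvd s0)" by blast
    then consider "P' dvd s0" | "Q' dvd s0" using d[OF s0(1) assms(1)] by auto
    then show ?thesis
    proof cases
      case 1
      then have "\<not> Q dvd s0" using s0(2) dvd_trans[OF PQ(1)] by blast
      then have "\<forall>s\<in>S. P' dvd s" using one[of Q' P' Q s0] d PQ(2) s0(1) 1 by blast
      then show ?thesis by blast
    next
      case 2
      then have "\<not> P dvd s0" using s0(2) dvd_trans[OF PQ(2)] by blast
      then have "\<forall>s\<in>S. Q' dvd s" using one[of P' Q' P s0] d PQ(1) s0(1) 2 by blast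
      then show ?thesis by blast
    qed
  qed blast
qed

text \<open>Otherwise \<open>D\<close> would be a factor of the multiples of \<open>c r\<close>, a group of order \<open>p^(a + 1)\<close>.\<close>

lemma not_tiles_prime_power_multiples:
  fixes c p q :: nat
  assumes t: "tiles (int (c * p ^ Suc a * r)) (int c) C D" and pos: "c > 0" "r > 0"
    and "prime p" "prime q" "p \<noteq> q" "card D = p * q"
    and D: "\<And>d. d \<in> D \<Longrightarrow> int (c * r) dvd d"
  shows False
proof -
  let ?w = "int (c * p ^ Suc a * r)"
  have w: "?w > 0" using pos prime_gt_0_nat[OF assms(4)] by simp
  have dvd: "int c dvd int (c * r)" "int (c * r) dvd ?w"
    unfolding int_dvd_int_iff by (simp_all add: mult_ac)
  have "tiles ?w (int (c * r)) {x \<in> C. int (c * r) dvd x} D"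
    using D by (intro tiles_restrict[OF t w dvd])
  then have "int (card {x \<in> C. int (c * r) dvd x} * card D) * int (c * r) = ?w"
    using tiles_card[OF _ w _ dvd(2)] pos by simp
  then have "card {x \<in> C. int (c * r) dvd x} * card D * (c * r) = p ^ Suc a * (c * r)"
    unfolding of_nat_mult[symmetric] of_nat_eq_iff by (simp add: mult_ac)
  then have "card {x \<in> C. int (c * r) dvd x} * (p * q) = p ^ Suc a"
    using pos assms(7) by simp
  then have "q dvd p ^ Suc a" by (metis dvd_triv_right dvd_mult)
  then have "q dvd p" using prime_dvd_power assms(5) by blast
  then show False using assms(4-6) primes_dvd_imp_eq by blast
qed

text \<open>Divides the common factor \<open>c\<close> out of \<open>e\<close> and \<open>w\<close>,
  leaving a divisor of \<open>M\<close> alone to which the bounds on large divisors apply.\<close>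

lemma large_gcd_divisor:
  fixes c M N :: nat
  assumes w: "w = int (c * M)" and "c > 0" "M > 0" and "int c dvd e" "int (N * c) < 2 * gcd e w"
  shows "\<exists>g. g dvd M \<and> N < 2 * g \<and> int (c * g) dvd e"
proof -
  obtain t where t: "e = int c * t" using assms(4) by blast
  define g where "g = nat (gcd t (int M))"
  have ig: "int g = gcd t (int M)" by (simp add: g_def)
  have "int g dvd int M" unfolding ig by simp
  then have "g dvd M" unfolding int_dvd_int_iff .
  moreover have "gcd e w = int (c * g)"
    unfolding t w of_nat_mult ig by (simp add: gcd_mult_left abs_mult)
  then have "int (N * c) < int (2 * g * c)" using assms(5) by (simp add: mult_ac)
  then have "N < 2 * g" unfolding of_nat_less_iff by simp
  moreover have "int (c * g) dvd e" unfolding t of_nat_mult ig by simp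
  ultimately show ?thesis by blast
qed

section \<open>The cases of one and of two common primes\<close>

text \<open>Comparing \<open>d\<close> with 0 in \<open>D\<close>, the gcd divided by
  \<open>u v\<close> is a divisor of \<open>p ^ (a + b)\<close> above half of \<open>p ^ a\<close>,
  hence a multiple of \<open>p ^ a\<close>.\<close>

lemma residues_inj_one_prime:
  fixes p a b u v :: nat
  assumes "prime p" and pos: "u > 0" "v > 0" and w: "w = int (p ^ a * p ^ b * u * v)"
    and "tiles w 1 A B" "card A = p ^ a * u" "card B = p ^ b * v"
    and "{0..L} \<subseteq> A" "A \<subseteq> {0..}" "L \<ge> 0" "2 * (L + 1) > int (p ^ a * u)"
    and "0 \<in> B" "B \<subseteq> {0..}" "coprime u (p ^ b * v)" "coprime v (p ^ a * u)"
  shows "inj_on (\<lambda>x. x mod int (p ^ a * u)) A"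
proof -
  have pp: "p ^ i > 0" for i using prime_gt_0_nat[OF assms(1)] by simp
  obtain C D where CD: "tiles w (int (u * v)) C D" "card D = p ^ b" "0 \<in> C" "0 \<in> D"
    and sep: "\<And>d d'. d \<in> D \<Longrightarrow> d' \<in> D \<Longrightarrow> d \<noteq> d' \<Longrightarrow> int (p ^ a * (u * v)) < 2 * gcd (d - d') w"
    and inj: "\<forall>d\<in>D. int (p ^ a * (u * v)) dvd d \<Longrightarrow> inj_on (\<lambda>x. x mod int (p ^ a * u)) A"
    using reduced_tiling[OF pp pp pos w assms(5-15)] by blast
  show ?thesis
  proof (rule inj, rule ballI)
    fix d assume d: "d \<in> D"
    show "int (p ^ a * (u * v)) dvd d"
    proof (cases "d = 0")
      case False
      have w': "w = int (u * v * p ^ (a + b))" unfolding w by (simp add: power_add mult_ac)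
      have uv: "int (u * v) dvd d"
        using tiles_dvd[OF CD(1) _ CD(3) d] unfolding w' by simp
      have "u * v > 0" using pos by simp
      moreover have "int (p ^ a * (u * v)) < 2 * gcd d w" using sep[OF d CD(4) False] by simp
      ultimately obtain g where g: "g dvd p ^ (a + b)" "p ^ a < 2 * g" "int (u * v * g) dvd d"
        using large_gcd_divisor[OF w' _ pp uv] by blast
      have "p ^ a dvd g" using large_prime_power_divisor[OF assms(1) g(1,2)] .
      then have "u * v * p ^ a dvd u * v * g" by (rule mult_dvd_mono[OF dvd_refl])
      then have "int (p ^ a * (u * v)) dvd int (u * v * g)"
        unfolding int_dvd_int_iff by (simp only: mult.commute[of "u * v"])
      then show ?thesis using g(3) by (rule dvd_trans)
    qed simp
  qed
qed

text \<open>With \<open>card D = p * q\<close>, the reduced group has order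
  \<open>p ^ Suc a * q ^ Suc b\<close>: each exponent is only one above that in \<open>N\<close>,
  which leaves three possibilities for a difference in \<open>D\<close>.\<close>

lemma residues_inj_two_primes:
  fixes p q a b u v :: nat
  assumes pq: "prime p" "prime q" "p \<noteq> q" and pos: "u > 0" "v > 0"
    and w: "w = int (p ^ a * q ^ b * (p * q) * u * v)"
    and "tiles w 1 A B" "card A = p ^ a * q ^ b * u" "card B = p * q * v"
    and "{0..L} \<subseteq> A" "A \<subseteq> {0..}" "L \<ge> 0" "2 * (L + 1) > int (p ^ a * q ^ b * u)"
    and "0 \<in> B" "B \<subseteq> {0..}" "coprime u (p * q * v)" "coprime v (p ^ a * q ^ b * u)"
  shows "inj_on (\<lambda>x. x mod int (p ^ a * q ^ b * u)) A"
proof -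
  define c where "c = u * v"
  have c0: "c > 0" using pos by (simp add: c_def)
  have pp: "p > 0" "q > 0" using prime_gt_0_nat pq by blast+
  have N0: "p ^ a * q ^ b > 0" "p * q > 0" using pp by simp_all
  obtain C D where CD: "tiles w (int c) C D" "card D = p * q" "0 \<in> C" "0 \<in> D"
    and sep: "\<And>d d'. d \<in> D \<Longrightarrow> d' \<in> D \<Longrightarrow> d \<noteq> d' \<Longrightarrow>
      int (p ^ a * q ^ b * c) < 2 * gcd (d - d') w"
    and inj: "\<forall>d\<in>D. int (p ^ a * q ^ b * c) dvd d \<Longrightarrow>
      inj_on (\<lambda>x. x mod int (p ^ a * q ^ b * u)) A"
    using reduced_tiling[OF N0 pos w assms(7-17)] unfolding c_def by blast
  have w': "w = int (c * (p ^ Suc a * q ^ Suc b))" unfolding w c_def by (simp add: mult_ac)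
  have "int c dvd d" if "d \<in> D" for d
    using tiles_dvd[OF CD(1) _ CD(3) that] unfolding w' by simp
  then have cdiff: "int c dvd d - d'" if "d \<in> D" "d' \<in> D" for d d' using that by (simp add: dvd_diff)
  let ?P' = "int (c * p ^ Suc a)" and ?Q' = "int (c * q ^ Suc b)"
  let ?P = "int (c * p ^ a)" and ?Q = "int (c * q ^ b)"
  have diff: "?P' dvd d - d' \<or> ?Q' dvd d - d' \<or> (?P dvd d - d' \<and> ?Q dvd d - d')"
    if d: "d \<in> D" "d' \<in> D" for d d'
  proof (cases "d = d'")
    case False
    have "p ^ Suc a * q ^ Suc b > 0" using pp by simp
    then obtain g where g: "g dvd p ^ Suc a * q ^ Suc b" "p ^ a * q ^ b < 2 * g" "int (c * g) dvd d - d'"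
      using large_gcd_divisor[OF w' c0 _ cdiff[OF d] sep[OF d False]] by blast
    have *: "int (c * x) dvd d - d'" if "x dvd g" for x
      using that g(3) by (intro dvd_trans[OF _ g(3)]) (simp only: int_dvd_int_iff mult_dvd_mono dvd_refl)
    consider "p ^ Suc a dvd g" | "q ^ Suc b dvd g" | "p ^ a * q ^ b dvd g"
      using large_divisor_two_primes[OF pq(1,2) g(1,2)] by blast
    then show ?thesis
    proof cases
      case 3
      then show ?thesis using *[of "p ^ a"] *[of "q ^ b"] by (auto dest: dvd_mult_left dvd_mult_right)
    qed (use * in blast)+
  qed simp
  have "?P dvd ?P'" "?Q dvd ?Q'" by (simp_all only: int_dvd_int_iff power_Suc) simp_all
  then consider "\<forall>d\<in>D. ?P' dvd d" | "\<forall>d\<in>D. ?Q' dvd d" | "\<forall>d\<in>D. ?P dvd d \<and> ?Q dvd d"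
    using common_divisor_of_differences[OF CD(4) diff] by blast
  \<comment> \<open>In the first two cases \<open>card D = p * q\<close> would divide a power of a
    single prime. In the third, coprimality merges \<open>p ^ a\<close> and
    \<open>q ^ b\<close>.\<close>
  then show ?thesis
  proof cases
    case 1
    have "tiles (int (c * q ^ Suc b * p ^ Suc a)) (int c) C D"
      using CD(1) unfolding w' by (simp only: mult_ac)
    then show ?thesis
      using not_tiles_prime_power_multiples[of c q b "p ^ Suc a" C D p] c0 pp pq CD(2) 1
      by (simp add: mult.commute)
  next
    case 2
    have "tiles (int (c * p ^ Suc a * q ^ Suc b)) (int c) C D"
      using CD(1) unfolding w' by (simp only: mult_ac)
    then show ?thesis
      using not_tiles_prime_power_multiples[of c p a "q ^ Suc b" C D q] c0 pp pq CD(2) 2 by simp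
  next
    case 3
    have "coprime (p ^ a) (q ^ b)" using pq by (simp add: primes_coprime)
    show ?thesis
    proof (rule inj, rule ballI)
      fix d assume "d \<in> D"
      then have d: "?P dvd d" "?Q dvd d" using 3 by auto
      then obtain t where t: "d = int c * t" using \<open>\<And>d. d \<in> D \<Longrightarrow> int c dvd d\<close> \<open>d \<in> D\<close> by blast
      have "int (p ^ a) dvd t" "int (q ^ b) dvd t" using d c0 unfolding t by simp_all
      then have "int (p ^ a) * int (q ^ b) dvd t"
        using \<open>coprime (p ^ a) (q ^ b)\<close> by (intro divides_mult) (simp_all only: coprime_int_iff)
      then have "int c * (int (p ^ a) * int (q ^ b)) dvd d" unfolding t by (rule mult_dvd_mono[OF dvd_refl])
      then show "int (p ^ a * q ^ b * c) dvd d" unfolding of_nat_mult by (simp only: mult_ac)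
    qed
  qed
qed

section \<open>Transfer from the cyclic group, and the theorem\<close>

lemma factorization_imp_tiles:
  assumes "factorization (integer_mod_group w) A B" "w > 0"
  shows "tiles (int w) 1 A B" "A \<subseteq> {0..<int w}" "B \<subseteq> {0..<int w}"
proof -
  have car: "carrier (integer_mod_group w) = {0..<int w}"
    using assms(2) by (simp add: carrier_integer_mod_group)
  note fac = assms(1)[unfolded factorization_def car mult_integer_mod_group]
  from fac show "A \<subseteq> {0..<int w}" by (elim conjE)
  from fac show "B \<subseteq> {0..<int w}" by (elim conjE)
  have ex1: "\<exists>!(a, b). a \<in> A \<and> b \<in> B \<and> g = (a + b) mod int w" if "g \<in> {0..<int w}" for g
    using fac that by (elim conjE) (rule bspec)
  show "tiles (int w) 1 A B"
  proof (rule tilesI)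
    show "\<exists>x\<in>A. \<exists>y\<in>B. int w dvd z - (x + y)" for z
    proof -
      have "z mod int w \<in> {0..<int w}" using assms(2) by simp
      from ex1_implies_ex[OF ex1[OF this]]
      obtain x y where "x \<in> A" "y \<in> B" "z mod int w = (x + y) mod int w" by blast
      then show ?thesis by (auto simp only: mod_eq_dvd_iff)
    qed
    fix x y x' y'
    assume xy: "x \<in> A" "y \<in> B" "x' \<in> A" "y' \<in> B" "int w dvd (x + y) - (x' + y')"
    have "(x + y) mod int w = (x' + y') mod int w" using xy(5) by (simp only: mod_eq_dvd_iff)
    moreover have "(x + y) mod int w \<in> {0..<int w}" using assms(2) by simp
    moreover from ex1[OF this] obtain z where
      "\<And>a b. a \<in> A \<Longrightarrow> b \<in> B \<Longrightarrow> (x + y) mod int w = (a + b) mod int w \<Longrightarrow> (a, b) = z"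
      by (elim ex1E) auto
    ultimately have "(x, y) = z" "(x', y') = z" using xy(1-4) by blast+
    then have "(x, y) = (x', y')" by simp
    then show "x = x' \<and> y = y'" by simp
  qed (use assms(2) in auto)
qed

lemma prime_power_split:
  fixes n p :: nat
  assumes "n > 0" "prime p"
  obtains a u where "n = p ^ a * u" "\<not> p dvd u" "u > 0"
proof -
  obtain u where "n = p ^ multiplicity p n * u" "\<not> p dvd u"
    using multiplicity_decompose'[of n p] assms by (metis not_prime_unit not_gr_zero)
  then show ?thesis using that assms(1) by (metis dvd_0_right not_gr_zero)
qed

text \<open>Splits the common primes off \<open>n\<close> and \<open>m\<close> so that the cofactors
  \<open>u\<close> and \<open>v\<close> meet the coprimality conditions of the two cases.\<close>

lemma residues_inj:
  fixes n m :: nat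
  assumes "n > 0" "m > 0" and w: "w = int (n * m)"
    and tile: "tiles w 1 A B" "card A = n" "card B = m"
    and A: "{0..L} \<subseteq> A" "A \<subseteq> {0..}" "L \<ge> 0" "2 * (L + 1) > int n"
    and B: "0 \<in> B" "B \<subseteq> {0..}"
    and gcd: "num_prime_divisors (gcd n m) \<le> 1
         \<or> (\<exists>p q :: nat. prime p \<and> prime q \<and> p \<noteq> q \<and> gcd n m = p * q
              \<and> gcd (p * q) (m div gcd n m) = 1)"
  shows "inj_on (\<lambda>x. x mod int n) A"
  using gcd
proof (elim disjE exE conjE)
  assume le: "num_prime_divisors (gcd n m) \<le> 1"
  define S where "S = {r. prime r \<and> r dvd gcd n m}"
  have "finite S"
    by (rule finite_subset[of _ "{..gcd n m}"]) (use assms(1) in \<open>auto simp: S_def intro: dvd_imp_le\<close>)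
  moreover have "card S \<le> Suc 0" using le by (simp add: num_prime_divisors_def S_def)
  ultimately have S1: "r = r'" if "r \<in> S" "r' \<in> S" for r r' using that card_le_Suc0_iff_eq by blast
  obtain p where p: "prime p" "\<And>r. r \<in> S \<Longrightarrow> r = p"
  proof (cases "S = {}")
    case True
    \<comment> \<open>Without a common prime any prime can serve as \<open>p\<close>.\<close>
    then show ?thesis using that[OF two_is_prime_nat] by blast
  next
    case False
    then obtain p where "p \<in> S" by blast
    then show ?thesis using that[of p] S1 unfolding S_def by blast
  qed
  obtain a u where n: "n = p ^ a * u" "\<not> p dvd u" "u > 0" using prime_power_split[OF assms(1) p(1)] .
  obtain b v where m: "m = p ^ b * v" "\<not> p dvd v" "v > 0" using prime_power_split[OF assms(2) p(1)] .
  have "coprime u v"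
  proof (rule coprimeI_prime)
    fix r assume r: "prime r" "r dvd u" "r dvd v"
    then have "r \<in> S" unfolding S_def n m by simp
    then show False using p(2) r(2) n(2) by blast
  qed (use m in simp)
  moreover have "coprime (p ^ i) u" "coprime (p ^ i) v" for i
    using prime_imp_coprime_nat[OF p(1)] n(2) m(2) by simp_all
  ultimately have "coprime u (p ^ b * v)" "coprime v (p ^ a * u)"
    by (simp_all add: coprime_commute)
  moreover have "w = int (p ^ a * p ^ b * u * v)" unfolding w n m by (simp add: mult_ac)
  ultimately show ?thesis
    using residues_inj_one_prime[OF p(1) n(3) m(3) _ tile(1) _ _ A(1-3) _ B] tile(2,3) A(4)
    unfolding n(1) m(1) by blast
next
  fix p q assume pq: "prime p" "prime q" "p \<noteq> q" and g: "gcd n m = p * q"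
    and cop: "gcd (p * q) (m div gcd n m) = 1"
  obtain a x where x: "n = p ^ a * x" "\<not> p dvd x" "x > 0" using prime_power_split[OF assms(1) pq(1)] .
  obtain b u where u: "x = q ^ b * u" "\<not> q dvd u" "u > 0" using prime_power_split[OF x(3) pq(2)] .
  have n: "n = p ^ a * q ^ b * u" using x u by (simp add: mult_ac)
  have pu: "\<not> p dvd u" using x(2) unfolding u(1) by (metis dvd_mult)
  define v where "v = m div gcd n m"
  have m: "m = p * q * v" unfolding v_def g[symmetric] by simp
  have v0: "v > 0" using assms(2) m by (cases v) auto
  \<comment> \<open>Thus \<open>p\<close> and \<open>q\<close> occur in \<open>m\<close> exactly
    once, giving \<open>K = p * q\<close>, while all their powers in \<open>n\<close> are collected
    in \<open>p ^ a * q ^ b\<close>.\<close>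
  have c: "coprime (p * q) v" using cop unfolding v_def g by (simp add: coprime_iff_gcd_eq_1)
  then have pv: "coprime p v" "coprime q v" by simp_all
  have pu': "coprime p u" "coprime q u"
    using prime_imp_coprime_nat pq(1,2) pu u(2) by blast+
  have "coprime u v"
  proof (rule coprimeI_prime)
    fix r assume r: "prime r" "r dvd u" "r dvd v"
    then have "r dvd gcd n m" unfolding n m by simp
    then have "r dvd p \<or> r dvd q" unfolding g using r(1) prime_dvd_mult_iff by blast
    then show False using pv r(1,3) by (meson coprime_common_divisor not_prime_unit)
  qed (use v0 in simp)
  then have "coprime u (p * q * v)" "coprime v (p ^ a * q ^ b * u)"
    using pv pu' by (simp_all add: coprime_commute)
  moreover have "w = int (p ^ a * q ^ b * (p * q) * u * v)" unfolding w n m by (simp add: mult_ac)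
  ultimately show ?thesis
    using residues_inj_two_primes[OF pq u(3) v0 _ tile(1) _ _ A(1-3) _ B] tile(2,3) A(4)
    unfolding n m by blast
qed

theorem theorem9:
  fixes \<omega> n k :: nat and i :: "nat \<Rightarrow> int" and A B :: "int set"
  assumes "\<omega> > 0" and "n > 0" and "k > 0" and "n \<ge> 2 * k + 1"
    and "factorization (integer_mod_group \<omega>) A B"
    and "A = reduced_interval \<omega> 0 (int n - int k - 1) \<union> i ` {..<k}"
    and "card A = n"
    and "num_prime_divisors (gcd (card A) (card B)) \<le> 1
         \<or> (\<exists>p q :: nat. prime p \<and> prime q \<and> p \<noteq> q \<and> gcd (card A) (card B) = p * q
              \<and> gcd (p * q) (card B div gcd (card A) (card B)) = 1)"
  shows "same_residues n (i ` {..<k}) {int n - int k..int n - 1}"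
proof -
  let ?w = "int \<omega>" and ?L = "int n - int k - 1" and ?f = "\<lambda>x::int. x mod int n"
  have w: "?w > 0" using assms(1) by simp
  note t = factorization_imp_tiles[OF assms(5,1)]
  have fin: "finite A" "finite B" "A \<noteq> {}" "B \<noteq> {}" using tiles_finite[OF t(1) w] .
  then have "n \<le> \<omega>" using card_mono[OF _ t(2)] assms(7) by simp
  \<comment> \<open>The right end \<open>n - k - 1\<close> is below the modulus, so reduction leaves
    the interval unchanged.\<close>
  then have J: "reduced_interval \<omega> 0 ?L = {0..?L}"
    unfolding reduced_interval_def using assms(3) by (subst image_cong[of _ "{0..?L}" _ "\<lambda>x. x"]) auto
  have A: "A = {0..?L} \<union> i ` {..<k}" using assms(6) unfolding J .
  obtain c where c: "c \<in> B" using fin(4) by blast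
  define B0 where "B0 = (\<lambda>y. (y - c) mod ?w) ` B"
  have t0: "tiles ?w 1 A B0" unfolding B0_def using tiles_translate[OF t(1) w] .
  have cardB: "int (n * card B) = ?w" using tiles_card[OF t(1) w] assms(7) by simp
  moreover have "int (n * card B0) = ?w" using tiles_card[OF t0 w] assms(7) by simp
  ultimately have "n * card B0 = n * card B" by linarith
  then have cB0: "card B0 = card B" using assms(2) by simp
  have "0 \<in> B0" unfolding B0_def using c by (intro image_eqI[of _ _ c]) auto
  moreover have "B0 \<subseteq> {0..}" unfolding B0_def using w by auto
  moreover have "card B > 0" using fin by (simp add: card_gt_0_iff)
  moreover have "{0..?L} \<subseteq> A" using A by blast
  moreover have "A \<subseteq> {0..}" using t(2) by auto
  \<comment> \<open>Here \<open>n \<ge> 2 * k + 1\<close> enters: the interval has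
    \<open>n - k\<close> elements, more than half of \<open>n\<close>.\<close>
  moreover have "?L \<ge> 0" "2 * (?L + 1) > int n" using assms(4) by simp_all
  ultimately have inj: "inj_on ?f A"
    using residues_inj[OF assms(2) _ cardB[symmetric] t0 assms(7) cB0 _ _ _ _ _ _ assms(8)[unfolded assms(7)]]
    by simp
  \<comment> \<open>With \<open>n\<close> elements and no repeated residue, \<open>A\<close> is a
    complete residue system modulo \<open>n\<close>.\<close>
  have "?f ` A \<subseteq> {0..<int n}" using assms(2) by auto
  moreover have "card (?f ` A) = card {0..<int n}" using card_image[OF inj] assms(7) by simp
  ultimately have full: "?f ` A = {0..<int n}" by (intro card_subset_eq) auto
  \<comment> \<open>The interval has \<open>n - k\<close> elements, the listed ones number at most
    \<open>k\<close>, and the union has \<open>n\<close>; so they cannot overlap. The listed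
    residues are then the complement of those of the interval.\<close>
  have "card ({0..?L} \<inter> i ` {..<k}) = 0"
  proof -
    have "card {0..?L} = n - k" using assms(4) by simp
    moreover have "card (i ` {..<k}) \<le> k" using card_image_le[of "{..<k}" i] by simp
    moreover have "card {0..?L} + card (i ` {..<k}) = n + card ({0..?L} \<inter> i ` {..<k})"
      using card_Un_Int[of "{0..?L}" "i ` {..<k}"] assms(7) A by simp
    ultimately show ?thesis using assms(4) by linarith
  qed
  then have disj: "{0..?L} \<inter> i ` {..<k} = {}" by simp
  have "i ` {..<k} = A - {0..?L}" using A disj by blast
  then have "?f ` i ` {..<k} = ?f ` A - ?f ` {0..?L}"
    using inj_on_image_set_diff[OF inj, of A "{0..?L}"] A by auto
  also have "?f ` {0..?L} = {0..?L}"
    by (subst image_cong[of _ "{0..?L}" _ "\<lambda>x. x"]) (use assms(3) in auto)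
  also have "?f ` A - {0..?L} = {int n - int k..int n - 1}" unfolding full using assms(4) by auto
  also have "\<dots> = ?f ` {int n - int k..int n - 1}"
    by (subst image_cong[of _ "{int n - int k..int n - 1}" _ "\<lambda>x. x"]) (use assms(4) in auto)
  finally show ?thesis unfolding same_residues_def .
qed

end
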